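(* Let $0<q<n$ be coprime integers and write $n=bq+r$ with $0\le r<q$. The ordered list $\mathcal{C}_{n,q}$ of $q$-cycles of $n$ may be constructed from the ordered list $\mathcal{C}_{q,-r}$ of $(-r)$-cycles of $q$ as follows: in each $(-r)$-cycle of $\mathcal{C}_{q,-r}$, taken in order, replace each element $y$ by the $q$-cycle $C_y$ of $n$; the resulting ordered list of $q$-cycles is $\mathcal{C}_{n,q}$. Consequently, the digit string built from $\mathcal{C}_{n,q}$ by the "$+i$ within, $+j$ between" rule may be constructed from $\mathcal{C}_{q,-r}$.
   Context: Cycles. For integers $1\le q\le n$ that are coprime and an integer $0\le a<q$, let $k$ be the largest integer with $a+kq<n$. The $q$-cycle of $a$ in $n$ is the arithmetic progression $C_a=(a,a+q,\dots,a+kq)$, with minimal element $a$ and maximal element $a+kq$. The $q$-cycles partition $\{0,\dots,n-1\}$. The ordered list $\mathcal{C}_{n,q}$ (the $(n,q)$-cycle) is the list of all $q$-cycles of $n$ starting with $C_0$, in which a cycle with maximal element $M$ is followed by the cycle with minimal element $M+q-n$. Thus its concatenation is the sequence $0,q,2q,\dots,(n-1)q$ reduced modulo $n$. The list $\mathcal{C}_{q,-r}$ is the analogous ordered list for the orbit $0,-r,-2r,\dots,-(q-1)r$ modulo $q$. That is, $\mathcal{C}_{q,-r}=\mathcal{C}_{q,s}$ is the ordered list of $s$-cycles of $q$, where $s=q-r$ represents $-r$ modulo $q$. "$+i$ within, $+j$ between" rule. Given $m\ge2$ and residues $i,j$ modulo $m$, the digit string built from $\mathcal{C}_{n,q}$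 is $d_0=0$ and, for $k\ge1$, with $e_k=kq\bmod n$: $d_k\equiv d_{k-1}+i\pmod m$ if $e_k$ follows $e_{k-1}$ within a $q$-cycle, and $d_k\equiv d_{k-1}+j \pmod m$ if $e_k$ is the minimal element of the next $q$-cycle in the (periodically repeated) list. *)

theory Defs
  imports Main
begin

definition qcycle :: "nat \<Rightarrow> nat \<Rightarrow> nat \<Rightarrow> nat list" where
  "qcycle n q a = map (\<lambda>t. a + t * q) [0..<Suc (GREATEST k. a + k * q < n)]"

text \<open>Natural-number subtraction does not truncate here: for \<open>a < q \<le> n\<close> the maximal element
  \<open>M\<close> of the cycle of \<open>a\<close> satisfies \<open>n \<le> M + q\<close>.\<close>

definition next_min :: "nat \<Rightarrow> nat \<Rightarrow> nat \<Rightarrow> nat" where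
  "next_min n q a = last (qcycle n q a) + q - n"

text \<open>There are exactly \<open>q\<close> cycles (one for each minimal element \<open>a < q\<close>), so the list of all of
  them is obtained by iterating the successor rule \<open>q - 1\<close> times from the cycle of \<open>0\<close>.\<close>

definition cycle_list :: "nat \<Rightarrow> nat \<Rightarrow> nat list list" where
  "cycle_list n q = map (\<lambda>t. qcycle n q ((next_min n q ^^ t) 0)) [0..<q]"

definition substitute_cycles :: "nat \<Rightarrow> nat \<Rightarrow> nat list list \<Rightarrow> nat list list" where
  "substitute_cycles n q L = concat (map (\<lambda>c. map (qcycle n q) c) L)"

definition follows_within :: "nat list list \<Rightarrow> nat \<Rightarrow> nat \<Rightarrow> bool" where
  "follows_within L x y \<longleftrightarrow>
     (\<exists>c \<in> set L. \<exists>t. Suc t < length c \<and> c ! t = x \<and> c ! Suc t = y)"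

text \<open>The rule ``\<open>+i\<close> within, \<open>+j\<close> between'' for a list \<open>L\<close> of disjoint cycles whose entries are run
  through, periodically, by the sequence \<open>e\<close>. A step that is not within a cycle leads to
  the first entry of the next cycle (possibly the same cycle again, if \<open>L\<close> has only one).
  Digits are the representatives in \<open>{0..<m}\<close>.\<close>

primrec digit_rule ::
  "nat \<Rightarrow> nat \<Rightarrow> nat \<Rightarrow> nat list list \<Rightarrow> (nat \<Rightarrow> nat) \<Rightarrow> nat \<Rightarrow> nat" where
  "digit_rule m i j L e 0 = 0"
| "digit_rule m i j L e (Suc k) =
     (digit_rule m i j L e k + (if follows_within L (e k) (e (Suc k)) then i else j)) mod m"

definition digit_string :: "nat \<Rightarrow> nat \<Rightarrow> nat \<Rightarrow> nat \<Rightarrow> nat \<Rightarrow> nat \<Rightarrow> nat" where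
  "digit_string m i j n q = digit_rule m i j (cycle_list n q) (\<lambda>k. k * q mod n)"

text \<open>The same rule for an arbitrary ordered list of cycles, where the sequence is read off
  from the list itself, periodically repeated.\<close>

definition digits_of_list :: "nat \<Rightarrow> nat \<Rightarrow> nat \<Rightarrow> nat list list \<Rightarrow> nat \<Rightarrow> nat" where
  "digits_of_list m i j L =
     digit_rule m i j L (\<lambda>k. concat L ! (k mod length (concat L)))"

end

theory Submission
  imports Defs
begin

text \<open>Passing from one \<open>q\<close>-cycle of \<open>n\<close> to the next subtracts \<open>n\<close> from a number of the same
  residue modulo \<open>q\<close>, so it translates minimal elements by \<open>- n\<close>, that is by \<open>- r\<close>, modulo
  \<open>q\<close>: the minimal elements, in order, are the orbit \<open>0, -r, -2r, \<dots>\<close> modulo \<open>q\<close>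
  (\<open>iterate_next_min\<close>). On the other hand, running through a cycle list visits the orbit
  of its step length, because only the passage between two cycles wraps around the modulus
  (\<open>concat_cycle_list\<close>). For the list of \<open>(-r)\<close>-cycles of \<open>q\<close>, the second fact says that its
  entries, in order, are exactly the minimal elements of the \<open>q\<close>-cycles of \<open>n\<close>; replacing
  each entry \<open>y\<close> by the cycle of \<open>y\<close> therefore gives the list of \<open>q\<close>-cycles of \<open>n\<close>.

  For the list of \<open>q\<close>-cycles of \<open>n\<close>, the second fact says that the sequence \<open>k q mod n\<close>
  driving the digit string is the one read off periodically from the list, so the digit string
  depends on the list only.\<close>

lemma qcycle_unfold:
  assumes "0 < q" "a < n"
  obtains l where "qcycle n q a = map (\<lambda>t. a + t * q) [0..<Suc l]"
    and "a + l * q < n" and "n \<le> a + Suc l * q"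
proof -
  define l where "l = (GREATEST k. a + k * q < n)"
  have bound: "k \<le> n" if "a + k * q < n" for k
  proof -
    have "k * 1 \<le> k * q"
      using \<open>0 < q\<close> by (intro mult_le_mono2) simp
    then show ?thesis using that by linarith
  qed
  have "a + l * q < n"
    unfolding l_def by (rule GreatestI_nat[where k = 0 and b = n]) (use \<open>a < n\<close> bound in auto)
  moreover have "n \<le> a + Suc l * q"
  proof (rule ccontr)
    assume "\<not> n \<le> a + Suc l * q"
    then have "Suc l \<le> l"
      unfolding l_def by (intro Greatest_le_nat[where b = n]) (use bound in auto)
    then show False by simp
  qed
  moreover have "qcycle n q a = map (\<lambda>t. a + t * q) [0..<Suc l]"
    by (simp add: qcycle_def l_def)
  ultimately show ?thesis using that by blast
qed

lemma next_min_eq: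
  assumes "qcycle n q a = map (\<lambda>t. a + t * q) [0..<Suc l]" and "n \<le> a + Suc l * q"
  shows "next_min n q a + n = a + Suc l * q"
  using assms by (simp add: next_min_def)

lemma next_min_less:
  assumes "0 < q" "q \<le> n" "a < q"
  shows "next_min n q a < q"
proof -
  obtain l where l: "qcycle n q a = map (\<lambda>t. a + t * q) [0..<Suc l]"
      "a + l * q < n" "n \<le> a + Suc l * q"
    using qcycle_unfold[of q a n] assms by auto
  show ?thesis using next_min_eq[OF l(1,3)] l(2) by simp
qed

lemma iterate_next_min_less:
  assumes "0 < q" "q \<le> n"
  shows "(next_min n q ^^ t) 0 < q"
  by (induction t) (use assms next_min_less in auto)

text \<open>An element that leaves \<open>{0..<n}\<close> under the step \<open>+q\<close> returns by subtracting \<open>n\<close>, and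
  modulo \<open>q\<close> only this subtraction is visible.\<close>

lemma next_min_mod:
  assumes "0 < q" "q \<le> n" "a < q"
  shows "next_min n q a = (a + (q - n mod q)) mod q"
proof -
  obtain l where l: "qcycle n q a = map (\<lambda>t. a + t * q) [0..<Suc l]"
      "a + l * q < n" "n \<le> a + Suc l * q"
    using qcycle_unfold[of q a n] assms by auto
  have n: "n = n div q * q + n mod q" by simp
  have "n mod q < q" using \<open>0 < q\<close> by simp
  then have split: "n + (q - n mod q) = Suc (n div q) * q"
    using n by (simp only: mult_Suc)
  have "a + (q - n mod q) + Suc l * q = next_min n q a + (n + (q - n mod q))"
    using next_min_eq[OF l(1,3)] by simp
  then have "a + (q - n mod q) + Suc l * q = next_min n q a + Suc (n div q) * q"
    by (simp only: split)
  then have "(a + (q - n mod q)) mod q = next_min n q a mod q"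
    by (metis mod_mult_self1)
  then show ?thesis using next_min_less[OF assms] by simp
qed

lemma iterate_next_min:
  assumes "0 < q" "q \<le> n"
  shows "(next_min n q ^^ t) 0 = t * (q - n mod q) mod q"
proof (induction t)
  case (Suc t)
  have "(next_min n q ^^ Suc t) 0 = ((next_min n q ^^ t) 0 + (q - n mod q)) mod q"
    using next_min_mod[OF assms iterate_next_min_less[OF assms]] by simp
  then show ?case by (simp add: Suc mod_simps add.commute)
qed simp

text \<open>Running through \<open>t\<close> complete cycles wraps around \<open>n\<close> exactly \<open>t\<close> times. So if they have
  \<open>S\<close> entries altogether, then the next minimal element is \<open>S q - t n\<close>; this is what keeps
  the entries of the following cycle in step with the orbit.\<close>

lemma concat_initial_cycles:
  assumes "0 < q" "q \<le> n"
  shows "\<exists>S. concat (map (\<lambda>u. qcycle n q ((next_min n q ^^ u) 0)) [0..<t])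
             = map (\<lambda>k. k * q mod n) [0..<S]
           \<and> S * q = (next_min n q ^^ t) 0 + t * n"
proof (induction t)
  case (Suc t)
  define a where "a = (next_min n q ^^ t) 0"
  from Suc obtain S where
    S: "concat (map (\<lambda>u. qcycle n q ((next_min n q ^^ u) 0)) [0..<t])
        = map (\<lambda>k. k * q mod n) [0..<S]"
    and Sq: "S * q = a + t * n"
    unfolding a_def by blast
  have "a < n"
    using iterate_next_min_less[OF assms, of t] assms by (simp add: a_def)
  then obtain l where l: "qcycle n q a = map (\<lambda>t. a + t * q) [0..<Suc l]"
      "a + l * q < n" "n \<le> a + Suc l * q"
    using qcycle_unfold[of q a n] assms by blast
  have "(S + u) * q mod n = a + u * q" if "u \<le> l" for u
  proof -
    have "a + u * q < n"
      using l(2) mult_le_mono1[OF that, of q] by linarith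
    moreover have "(S + u) * q = a + u * q + t * n"
      using Sq by (simp add: algebra_simps)
    ultimately show ?thesis by simp
  qed
  then have "qcycle n q a = map (\<lambda>k. k * q mod n) [S..<S + Suc l]"
    unfolding l(1) by (auto intro!: nth_equalityI simp del: upt_Suc)
  moreover have "[0..<S + Suc l] = [0..<S] @ [S..<S + Suc l]"
    by (rule upt_add_eq_append) simp
  ultimately have "concat (map (\<lambda>u. qcycle n q ((next_min n q ^^ u) 0)) [0..<Suc t])
      = map (\<lambda>k. k * q mod n) [0..<S + Suc l]"
    using S by (simp add: a_def del: upt_Suc add: upt_Suc_append)
  moreover have "(S + Suc l) * q = (next_min n q ^^ Suc t) 0 + Suc t * n"
    using Sq next_min_eq[OF l(1,3)] by (simp add: a_def algebra_simps)
  ultimately show ?case by blast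
qed simp

text \<open>After \<open>q\<close> cycles the minimal element is again \<open>0\<close>, so the number \<open>S\<close> of entries satisfies
  \<open>S q = q n\<close>: the list closes up after exactly \<open>n\<close> steps.\<close>

lemma concat_cycle_list:
  assumes "0 < q" "q \<le> n"
  shows "concat (cycle_list n q) = map (\<lambda>k. k * q mod n) [0..<n]"
proof -
  obtain S where S: "concat (cycle_list n q) = map (\<lambda>k. k * q mod n) [0..<S]"
    and Sq: "S * q = (next_min n q ^^ q) 0 + q * n"
    using concat_initial_cycles[OF assms, of q] unfolding cycle_list_def by blast
  have "S = n"
    using Sq \<open>0 < q\<close> by (simp add: iterate_next_min[OF assms])
  then show ?thesis using S by simp
qed

lemma substitute_cycles_eq:
  "substitute_cycles n q L = map (qcycle n q) (concat L)"
  by (simp add: substitute_cycles_def map_concat)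

lemma substitute_cycle_list:
  assumes "0 < q" "q \<le> n"
  shows "substitute_cycles n q (cycle_list q (q - n mod q)) = cycle_list n q"
proof -
  have "0 < q - n mod q" "q - n mod q \<le> q"
    using \<open>0 < q\<close> by simp_all
  from concat_cycle_list[OF this] show ?thesis
    by (simp add: substitute_cycles_eq cycle_list_def[of n q] iterate_next_min[OF assms])
qed

lemma digit_string_eq_digits_of_list:
  assumes "0 < q" "q \<le> n"
  shows "digit_string m i j n q = digits_of_list m i j (cycle_list n q)"
proof -
  have "concat (cycle_list n q) ! (k mod length (concat (cycle_list n q))) = k * q mod n" for k
    using assms by (simp add: concat_cycle_list mod_mult_left_eq)
  then show ?thesis
    by (simp add: digit_string_def digits_of_list_def)
qed

theorem theorem3p6:
  fixes n q b r :: nat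
  assumes "0 < q" and "q < n" and "coprime q n"
    and "n = b * q + r" and "r < q"
  shows "substitute_cycles n q (cycle_list q (q - r)) = cycle_list n q \<and>
    (\<forall>m i j. 2 \<le> m \<longrightarrow> i < m \<longrightarrow> j < m \<longrightarrow>
      (\<forall>k. digit_string m i j n q k =
        digits_of_list m i j (substitute_cycles n q (cycle_list q (q - r))) k))"
proof -
  have "q \<le> n" using assms by simp
  have "n mod q = r" using assms by simp
  then have "substitute_cycles n q (cycle_list q (q - r)) = cycle_list n q"
    using substitute_cycle_list[OF \<open>0 < q\<close> \<open>q \<le> n\<close>] by simp
  then show ?thesis
    by (simp add: digit_string_eq_digits_of_list[OF \<open>0 < q\<close> \<open>q \<le> n\<close>])
qed

end
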